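(* Let $\Phi,\Psi$ be invertible $N_x\times N_x$ matrices with $\|\Phi^q\|<1$, $\|\Psi^q\|<1$ for some $q\ge1$ (fine- and coarse-grid time-stepping operators), with coarsening factor $k$ and $N_c$ coarse-grid time points. Assume that $\Phi$ and $\Psi$ commute and are diagonalizable, with common eigenvectors given as columns of $U$. Suppose that $\Phi$ satisfies an F-TEAP with respect to $\Psi$, with (smallest) constant $\varphi_F$. Then, for $p\ge1$, $$\|(I-A_\Delta B_\Delta^{-1})^p\|_{(UU^* )^{-1}}^2=\varphi_F^{2p}-O(1/N_c^2).$$ Similarly, suppose that $\Phi$ satisfies an FCF-TEAP with respect to $\Psi$, with (smallest) constant $\varphi_{FCF}$. Then, for $p\ge1$, $$\left\|\left((I-A_\Delta B_\Delta^{-1})A_{cf}A_{ff}^{-1}A_{fc}\right)^p\right\|_{(UU^* )^{-1}}^2=\varphi_{FCF}^{2p}-O(1/N_c^2).$$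
   Context: $A_\Delta$ and $B_\Delta$ are the $N_c\times N_c$ block matrices (blocks of size $N_x\times N_x$) with identity blocks on the diagonal, zeros elsewhere except on the first block subdiagonal, where $A_\Delta$ has $-\Phi^k$ and $B_\Delta$ has $-\Psi$. $A_{cf}A_{ff}^{-1}A_{fc}$ is the $N_c\times N_c$ block matrix with $\Phi^k$ on the first block subdiagonal and zeros elsewhere. For a block vector $\mathbf{x}$ with blocks $\mathbf{x}_j\in\mathbb{C}^{N_x}$, $\|\mathbf{x}\|_{(UU^* )^{-1}}^2=\sum_j\|U^{-1}\mathbf{x}_j\|^2$, with the induced operator norm on block matrices. TEAP (temporal eigenvalue approximation property): let $\lambda_\ell$, $\mu_\ell$ be the eigenvalues of $\Phi$, $\Psi$ for the $\ell$th column of $U$. $\Phi$ satisfies an F-TEAP with respect to $\Psi$ with constant $\varphi_F$ if $|\mu_\ell-\lambda_\ell^k|\le\varphi_F(1-|\mu_\ell|)$ for all $\ell$, and an FCF-TEAP with constant $\varphi_{FCF}$ if $|\mu_\ell-\lambda_\ell^k|\le\varphi_{FCF}\frac{1-|\mu_\ell|}{|\lambda_\ell^k|}$ for all $\ell$. Convention: $O(1/N_c^2)$ denotes a nonnegative quantity bounded by $C/N_c^2$ as $N_c\to\infty$ with $\Phi,\Psi,k,p$ fixed. *)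

theory Defs
  imports "HOL-Analysis.Analysis" "HOL-Library.Landau_Symbols"
begin

text \<open>
  Spatial operators are square complex matrices over a finite index type \<open>'n\<close>, with
  \<open>N\<^sub>x = CARD('n)\<close>. The number \<open>N\<close> of coarse time points must remain a variable for the
  asymptotic statements, so block vectors and block matrices are functions on natural
  numbers, and only their entries with indices below \<open>N\<close> are meaningful.
\<close>

type_synonym 'n block_vec = "nat \<Rightarrow> complex^'n"
type_synonym 'n block_mat = "nat \<Rightarrow> nat \<Rightarrow> complex^'n^'n"

text \<open>The class power \<open>A ^ m\<close> on \<open>complex^'n^'n\<close> is componentwise.\<close>

definition matpow :: "complex^'n^'n \<Rightarrow> nat \<Rightarrow> complex^'n^'n"
  where "matpow A m = (((**) A) ^^ m) (mat 1)"

definition bm_one :: "('n::finite) block_mat"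
  where "bm_one i j = (if i = j then mat 1 else 0)"

definition bm_mult :: "nat \<Rightarrow> ('n::finite) block_mat \<Rightarrow> 'n block_mat \<Rightarrow> 'n block_mat"
  where "bm_mult N A B i j = (\<Sum>l<N. A i l ** B l j)"

definition bm_power :: "nat \<Rightarrow> ('n::finite) block_mat \<Rightarrow> nat \<Rightarrow> 'n block_mat"
  where "bm_power N A p = ((bm_mult N A) ^^ p) bm_one"

text \<open>A choice of two-sided inverse, as in the library's \<open>matrix_inv\<close>. Its entries below \<open>N\<close> are unique when an
  inverse exists.\<close>

definition bm_inv :: "nat \<Rightarrow> ('n::finite) block_mat \<Rightarrow> 'n block_mat"
  where "bm_inv N A = (SOME X. \<forall>i<N. \<forall>j<N.
           bm_mult N A X i j = bm_one i j \<and> bm_mult N X A i j = bm_one i j)"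

definition bm_vec :: "nat \<Rightarrow> ('n::finite) block_mat \<Rightarrow> 'n block_vec \<Rightarrow> 'n block_vec"
  where "bm_vec N A x i = (\<Sum>j<N. A i j *v x j)"

text \<open>The norm weighted by \<open>(UU\<^sup>*)\<^sup>-\<^sup>1\<close>; the induced operator norm follows the
  library's \<^const>\<open>onorm\<close>, where the zero vector contributes \<open>0 / 0 = 0\<close>.\<close>

definition bv_norm :: "nat \<Rightarrow> complex^'n^'n \<Rightarrow> ('n::finite) block_vec \<Rightarrow> real"
  where "bv_norm N U x = sqrt (\<Sum>j<N. (norm (matrix_inv U *v x j))\<^sup>2)"

definition bm_norm :: "nat \<Rightarrow> complex^'n^'n \<Rightarrow> ('n::finite) block_mat \<Rightarrow> real"
  where "bm_norm N U A = (SUP x. bv_norm N U (bm_vec N A x) / bv_norm N U x)"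

definition A_Delta :: "complex^'n^'n \<Rightarrow> nat \<Rightarrow> ('n::finite) block_mat"
  where "A_Delta \<Phi> k i j =
           (if i = j then mat 1 else if i = Suc j then - matpow \<Phi> k else 0)"

definition B_Delta :: "complex^'n^'n \<Rightarrow> ('n::finite) block_mat"
  where "B_Delta \<Psi> i j =
           (if i = j then mat 1 else if i = Suc j then - \<Psi> else 0)"

text \<open>The product \<open>A\<^sub>c\<^sub>f A\<^sub>f\<^sub>f\<^sup>-\<^sup>1 A\<^sub>f\<^sub>c\<close>.\<close>

definition A_cffc :: "complex^'n^'n \<Rightarrow> nat \<Rightarrow> ('n::finite) block_mat"
  where "A_cffc \<Phi> k i j = (if i = Suc j then matpow \<Phi> k else 0)"

definition F_residual :: "nat \<Rightarrow> complex^'n^'n \<Rightarrow> complex^'n^'n \<Rightarrow> nat \<Rightarrow> ('n::finite) block_mat"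
  where "F_residual N \<Phi> \<Psi> k =
           bm_one - bm_mult N (A_Delta \<Phi> k) (bm_inv N (B_Delta \<Psi>))"

definition FCF_residual :: "nat \<Rightarrow> complex^'n^'n \<Rightarrow> complex^'n^'n \<Rightarrow> nat \<Rightarrow> ('n::finite) block_mat"
  where "FCF_residual N \<Phi> \<Psi> k = bm_mult N (F_residual N \<Phi> \<Psi> k) (A_cffc \<Phi> k)"

text \<open>\<open>lam\<close> lists the eigenvalues of \<open>M\<close> belonging to the columns of \<open>U\<close>. For invertible \<open>U\<close> the
  columns form a basis, and \<open>lam\<close> is determined by \<open>M\<close> and \<open>U\<close>.\<close>

definition diagonalized_by :: "complex^'n^'n \<Rightarrow> complex^'n^'n \<Rightarrow> ('n \<Rightarrow> complex) \<Rightarrow> bool"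
  where "diagonalized_by U M lam \<longleftrightarrow>
           invertible U \<and> (\<forall>l. M *v column l U = lam l *s column l U)"

definition F_TEAP :: "('n \<Rightarrow> complex) \<Rightarrow> ('n \<Rightarrow> complex) \<Rightarrow> nat \<Rightarrow> real \<Rightarrow> bool"
  where "F_TEAP lam mu k \<phi> \<longleftrightarrow>
           (\<forall>l. cmod (mu l - lam l ^ k) \<le> \<phi> * (1 - cmod (mu l)))"

definition FCF_TEAP :: "('n \<Rightarrow> complex) \<Rightarrow> ('n \<Rightarrow> complex) \<Rightarrow> nat \<Rightarrow> real \<Rightarrow> bool"
  where "FCF_TEAP lam mu k \<phi> \<longleftrightarrow>
           (\<forall>l. cmod (mu l - lam l ^ k) \<le> \<phi> * ((1 - cmod (mu l)) / cmod (lam l ^ k)))"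

text \<open>The values \<open>f N\<close>, \<open>N \<ge> 1\<close>, equal \<open>c - O(1/N\<^sup>2)\<close> with a nonnegative \<open>O\<close>-term.\<close>

definition eq_minus_bigo_inv_square :: "(nat \<Rightarrow> real) \<Rightarrow> real \<Rightarrow> bool"
  where "eq_minus_bigo_inv_square f c \<longleftrightarrow>
           (\<exists>\<delta>. (\<forall>N\<ge>1. 0 \<le> \<delta> N \<and> f N = c - \<delta> N) \<and> \<delta> \<in> O(\<lambda>N. 1 / real N ^ 2))"

end

theory Submission
  imports Defs
begin

text \<open>
  In the eigenvector coordinates \<open>U\<^sup>-\<^sup>1 x\<^sub>j\<close> both residuals decouple into scalar strictly lower
  triangular Toeplitz operators \<open>c S\<^sup>e\<^sup>+\<^sup>1 (1 - \<mu> S)\<^sup>-\<^sup>1\<close>, \<open>S\<close> the shift, with \<open>e = 0\<close> and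
  \<open>c = \<lambda>\<^sup>k - \<mu>\<close> for F-relaxation, and \<open>e = 1\<close> and \<open>c = (\<lambda>\<^sup>k - \<mu>) \<lambda>\<^sup>k\<close> for FCF-relaxation. Such an
  operator has norm at most \<open>|c| / (1 - |\<mu>|)\<close>, and the least TEAP constant is the maximum of these
  quotients. For the lower bound one applies the \<open>p\<close>th power of the operator to \<open>(1 - \<mu> S)\<^sup>p v\<close>, which
  gives a multiple of a shift of \<open>v\<close>. Writing \<open>\<mu> = r u\<close> with \<open>|u| = 1\<close>,
  \<open>\<parallel>(1 - \<mu> S) v\<parallel>\<^sup>2 = (1 - r)\<^sup>2 \<parallel>v\<parallel>\<^sup>2 + r \<parallel>(1 - u S) v\<parallel>\<^sup>2\<close> for finitely supported \<open>v\<close>, and for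
  \<open>v\<^sub>j = u\<^sup>j (j + 1) (M - j)\<close> the last term is at most \<open>10 \<parallel>v\<parallel>\<^sup>2 / (M + 1)\<^sup>2\<close>.
\<close>

section \<open>The shift on sequences, its resolvent, and their commutation\<close>

definition shift :: "(nat \<Rightarrow> complex) \<Rightarrow> nat \<Rightarrow> complex"
  where "shift y i = (case i of 0 \<Rightarrow> 0 | Suc j \<Rightarrow> y j)"

text \<open>The operator \<open>S (1 - \<mu> S)\<^sup>-\<^sup>1\<close>.\<close>

primrec geo_shift :: "complex \<Rightarrow> (nat \<Rightarrow> complex) \<Rightarrow> nat \<Rightarrow> complex"
  where
    "geo_shift \<mu> y 0 = 0"
  | "geo_shift \<mu> y (Suc i) = \<mu> * geo_shift \<mu> y i + y i"

definition one_minus_shift :: "complex \<Rightarrow> (nat \<Rightarrow> complex) \<Rightarrow> nat \<Rightarrow> complex"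
  where "one_minus_shift \<mu> y i = y i - \<mu> * shift y i"

definition seq_norm :: "nat \<Rightarrow> (nat \<Rightarrow> complex) \<Rightarrow> real"
  where "seq_norm N y = L2_set (\<lambda>i. cmod (y i)) {..<N}"

lemma shift_0 [simp]: "shift y 0 = 0"
  and shift_Suc [simp]: "shift y (Suc i) = y i"
  by (simp_all add: shift_def)

lemma shift_cmult: "shift (\<lambda>i. c * y i) = (\<lambda>i. c * shift y i)"
  by (rule ext) (simp add: shift_def split: nat.split)

lemma shift_funpow_cmult: "(shift ^^ m) (\<lambda>i. c * y i) = (\<lambda>i. c * (shift ^^ m) y i)"
  by (induction m) (simp_all add: shift_cmult)

lemma shift_funpow: "(shift ^^ s) y i = (if i < s then 0 else y (i - s))"
  by (induction s arbitrary: i) (auto simp: shift_def split: nat.split)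

lemma one_minus_shift_cmult:
  "one_minus_shift \<mu> (\<lambda>i. c * y i) = (\<lambda>i. c * one_minus_shift \<mu> y i)"
  by (rule ext) (simp add: one_minus_shift_def shift_cmult algebra_simps)

lemma one_minus_shift_funpow_cmult:
  "(one_minus_shift \<mu> ^^ m) (\<lambda>i. c * y i) = (\<lambda>i. c * (one_minus_shift \<mu> ^^ m) y i)"
  by (induction m) (simp_all add: one_minus_shift_cmult)

lemma one_minus_shift_commute:
  "one_minus_shift \<mu> (one_minus_shift \<nu> y) = one_minus_shift \<nu> (one_minus_shift \<mu> y)"
  by (rule ext) (simp add: one_minus_shift_def shift_def algebra_simps split: nat.split)

lemma one_minus_shift_funpow_commute:
  "(one_minus_shift \<mu> ^^ m) (one_minus_shift \<nu> y) = one_minus_shift \<nu> ((one_minus_shift \<mu> ^^ m) y)"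
  by (induction m) (simp_all add: one_minus_shift_commute)

lemma shift_one_minus_shift: "shift (one_minus_shift \<mu> y) = one_minus_shift \<mu> (shift y)"
  by (rule ext) (simp add: one_minus_shift_def shift_def split: nat.split)

lemma shift_funpow_one_minus_shift:
  "(shift ^^ m) (one_minus_shift \<mu> y) = one_minus_shift \<mu> ((shift ^^ m) y)"
  by (induction m) (simp_all add: shift_one_minus_shift)

lemma shift_funpow_one_minus_shift_funpow:
  "(shift ^^ m) ((one_minus_shift \<mu> ^^ n) y) = (one_minus_shift \<mu> ^^ n) ((shift ^^ m) y)"
  by (induction n) (simp_all add: shift_funpow_one_minus_shift)

text \<open>\<open>geo_shift\<close> solves its recursion forward from index 0, so cancelling the
  resolvent against \<open>1 - \<mu> S\<close> is exact algebra, with no series involved.\<close>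

lemma geo_shift_one_minus_shift: "geo_shift \<mu> (one_minus_shift \<mu> y) = shift y"
proof
  fix i show "geo_shift \<mu> (one_minus_shift \<mu> y) i = shift y i"
    by (induction i) (simp_all add: one_minus_shift_def)
qed

text \<open>Strict lower triangularity: entry \<open>i\<close> reads only earlier entries. Hence
  operators may act on infinite sequences while only the norms cut off at \<open>N\<close>.\<close>

lemma geo_shift_cong: "(\<And>j. j < i \<Longrightarrow> y j = z j) \<Longrightarrow> geo_shift \<mu> y i = geo_shift \<mu> z i"
  by (induction i) simp_all

section \<open>Toeplitz operators and the cancellation in their powers\<close>

definition toeplitz :: "complex \<Rightarrow> complex \<Rightarrow> nat \<Rightarrow> (nat \<Rightarrow> complex) \<Rightarrow> nat \<Rightarrow> complex"
  where "toeplitz c \<mu> e y i = c * geo_shift \<mu> ((shift ^^ e) y) i"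

lemma toeplitz_cong:
  assumes "\<And>j. j < N \<Longrightarrow> y j = z j" and "i < N"
  shows "toeplitz c \<mu> e y i = toeplitz c \<mu> e z i"
  unfolding toeplitz_def using assms
  by (auto intro!: arg_cong[where f = "\<lambda>x. c * x"] geo_shift_cong simp: shift_funpow)

text \<open>All operators are built from the shift and commute, so each factor
  \<open>1 - \<mu> S\<close> cancels one resolvent. This makes the output norm explicit in the lower
  bound.\<close>

lemma toeplitz_funpow:
  "(toeplitz c \<mu> e ^^ p) ((one_minus_shift \<mu> ^^ p) y) = (\<lambda>i. c ^ p * (shift ^^ (Suc e * p)) y i)"
proof (induction p arbitrary: y)
  case 0
  then show ?case by simp
next
  case (Suc p)
  let ?w = "(one_minus_shift \<mu> ^^ p) y"
  have "toeplitz c \<mu> e (one_minus_shift \<mu> ?w) = (\<lambda>i. c * (shift ^^ Suc e) ?w i)"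
    by (rule ext) (simp add: toeplitz_def shift_funpow_one_minus_shift geo_shift_one_minus_shift)
  \<comment> \<open>The shifted sequence moves inside the remaining \<open>p\<close> factors. The
    induction hypothesis is then used for it in place of \<open>y\<close>, hence the generalization
    over \<open>y\<close>.\<close>
  also have "\<dots> = (one_minus_shift \<mu> ^^ p) (\<lambda>i. c * (shift ^^ Suc e) y i)"
    by (simp only: shift_funpow_one_minus_shift_funpow one_minus_shift_funpow_cmult)
  finally have "(toeplitz c \<mu> e ^^ Suc p) ((one_minus_shift \<mu> ^^ Suc p) y)
      = (toeplitz c \<mu> e ^^ p) ((one_minus_shift \<mu> ^^ p) (\<lambda>i. c * (shift ^^ Suc e) y i))"
    by (simp only: funpow_Suc_right o_apply one_minus_shift_funpow_commute)
  also have "\<dots> = (\<lambda>i. c ^ p * (shift ^^ (Suc e * p)) (\<lambda>i. c * (shift ^^ Suc e) y i) i)"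
    by (rule Suc.IH)
  also have "\<dots> = (\<lambda>i. c ^ Suc p * (shift ^^ (Suc e * p + Suc e)) y i)"
    by (simp only: shift_funpow_cmult funpow_add o_apply) (simp add: mult_ac)
  finally show ?case by (simp add: algebra_simps)
qed

section \<open>Truncated Euclidean norms and the upper bound\<close>

lemma seq_norm_nonneg: "0 \<le> seq_norm N y"
  by (simp add: seq_norm_def)

lemma seq_norm_power2: "(seq_norm N y)\<^sup>2 = (\<Sum>i<N. (cmod (y i))\<^sup>2)"
  by (simp add: seq_norm_def L2_set_def sum_nonneg)

lemma seq_norm_mult: "seq_norm N (\<lambda>i. c * y i) = cmod c * seq_norm N y"
  by (simp add: seq_norm_def norm_mult L2_set_right_distrib)

lemma seq_norm_add: "seq_norm N (\<lambda>i. y i + z i) \<le> seq_norm N y + seq_norm N z"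
  unfolding seq_norm_def
  by (rule order_trans[OF L2_set_mono L2_set_triangle_ineq]) (simp_all add: norm_triangle_ineq)

lemma seq_norm_shift: "(seq_norm (Suc N) (shift y))\<^sup>2 = (seq_norm N y)\<^sup>2"
  unfolding seq_norm_power2 by (subst sum.lessThan_Suc_shift) simp

lemma seq_norm_Suc_mono: "seq_norm N y \<le> seq_norm (Suc N) y"
  by (rule power2_le_imp_le) (simp_all add: seq_norm_power2 seq_norm_nonneg)

lemma seq_norm_shift_le: "seq_norm N (shift y) \<le> seq_norm N y"
  using seq_norm_Suc_mono[of N "shift y"] seq_norm_shift[of N y]
  by (simp add: seq_norm_nonneg power2_eq_iff_nonneg)

lemma seq_norm_shift_funpow_le: "seq_norm N ((shift ^^ e) y) \<le> seq_norm N y"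
  by (induction e) (auto intro: order_trans[OF seq_norm_shift_le])

text \<open>A window longer by \<open>s\<close> keeps every shifted entry, and the entries that come
  in at the front are zero.\<close>

lemma seq_norm_shift_funpow: "seq_norm (M + s) ((shift ^^ s) y) = seq_norm M y"
  by (induction s) (use seq_norm_shift in \<open>simp_all add: seq_norm_nonneg power2_eq_iff_nonneg\<close>)

text \<open>\<open>g = geo_shift \<mu> y\<close> satisfies \<open>g = \<mu> S g + S y\<close>. The
  shift does not increase the norm, so the triangle inequality gives
  \<open>(1 - |\<mu>|) ||g|| \<le> ||y||\<close>.\<close>

lemma seq_norm_geo_shift:
  assumes "cmod \<mu> < 1"
  shows "seq_norm N (geo_shift \<mu> y) \<le> seq_norm N y / (1 - cmod \<mu>)"
proof -
  have "geo_shift \<mu> y = (\<lambda>i. \<mu> * shift (geo_shift \<mu> y) i + shift y i)"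
  proof
    fix i show "geo_shift \<mu> y i = \<mu> * shift (geo_shift \<mu> y) i + shift y i"
      by (cases i) simp_all
  qed
  then have "seq_norm N (geo_shift \<mu> y)
      \<le> cmod \<mu> * seq_norm N (shift (geo_shift \<mu> y)) + seq_norm N (shift y)"
    by (metis seq_norm_add seq_norm_mult)
  also have "\<dots> \<le> cmod \<mu> * seq_norm N (geo_shift \<mu> y) + seq_norm N y"
    by (intro add_mono mult_left_mono seq_norm_shift_le) simp
  finally show ?thesis using assms by (simp add: field_simps)
qed

lemma seq_norm_toeplitz_funpow:
  assumes "cmod \<mu> < 1" and "cmod c \<le> \<phi> * (1 - cmod \<mu>)"
  shows "seq_norm N ((toeplitz c \<mu> e ^^ p) y) \<le> \<phi> ^ p * seq_norm N y"
proof (induction p)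
  case 0
  then show ?case by simp
next
  case (Suc p)
  have phi: "cmod c / (1 - cmod \<mu>) \<le> \<phi>" using assms by (simp add: field_simps)
  then have "0 \<le> \<phi>" using assms(1) by (smt (verit) divide_nonneg_pos norm_ge_zero)
  have step: "seq_norm N (toeplitz c \<mu> e z) \<le> \<phi> * seq_norm N z" for z
  proof -
    have "seq_norm N (toeplitz c \<mu> e z) = cmod c * seq_norm N (geo_shift \<mu> ((shift ^^ e) z))"
      unfolding toeplitz_def[abs_def] by (rule seq_norm_mult)
    also have "\<dots> \<le> cmod c * (seq_norm N z / (1 - cmod \<mu>))"
      using assms(1) by (intro mult_left_mono order_trans[OF seq_norm_geo_shift] divide_right_mono
          seq_norm_shift_funpow_le) auto
    also have "\<dots> \<le> \<phi> * seq_norm N z"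
      using mult_right_mono[OF phi seq_norm_nonneg[of N z]] by simp
    finally show ?thesis .
  qed
  have "seq_norm N ((toeplitz c \<mu> e ^^ Suc p) y) \<le> \<phi> * seq_norm N ((toeplitz c \<mu> e ^^ p) y)"
    using step by simp
  also have "\<dots> \<le> \<phi> * (\<phi> ^ p * seq_norm N y)"
    by (rule mult_left_mono[OF Suc \<open>0 \<le> \<phi>\<close>])
  finally show ?case by (simp add: mult_ac)
qed

section \<open>The norm identity for \<open>1 - \<mu> S\<close> and its powers\<close>

text \<open>Expand \<open>|a - t u b|^2\<close> at \<open>t = r\<close> and at \<open>t = 1\<close>
  and eliminate the common cross term.\<close>

lemma cmod_diff_mult_power2:
  assumes "cmod u = 1"
  shows "(cmod (a - of_real r * u * b))\<^sup>2
    = (1 - r) * (cmod a)\<^sup>2 - r * (1 - r) * (cmod b)\<^sup>2 + r * (cmod (a - u * b))\<^sup>2"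
proof -
  have *: "(cmod (a - of_real t * z))\<^sup>2
      = (cmod a)\<^sup>2 - 2 * t * Re (a * cnj z) + t\<^sup>2 * (cmod z)\<^sup>2" for t :: real and z
    by (simp add: cmod_power2) (simp add: power2_eq_square algebra_simps)
  define P where "P = Re (a * cnj (u * b))"
  have ub: "cmod (u * b) = cmod b" using assms by (simp add: norm_mult)
  have r: "(cmod (a - of_real r * u * b))\<^sup>2 = (cmod a)\<^sup>2 - 2 * r * P + r\<^sup>2 * (cmod b)\<^sup>2"
    using *[of r "u * b"] by (simp only: ub mult.assoc P_def)
  have 1: "(cmod (a - u * b))\<^sup>2 = (cmod a)\<^sup>2 - 2 * P + (cmod b)\<^sup>2"
    using *[of 1 "u * b"] by (simp add: ub P_def del: times_complex.simps complex_cnj_mult)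
  show ?thesis unfolding r 1 by (simp add: power2_eq_square algebra_simps)
qed

lemma seq_norm_one_minus_shift_le:
  "seq_norm N (one_minus_shift \<mu> y) \<le> (1 + cmod \<mu>) * seq_norm N y"
proof -
  have "seq_norm N (one_minus_shift \<mu> y) \<le> seq_norm N y + cmod (- \<mu>) * seq_norm N (shift y)"
    using seq_norm_add[of N y "\<lambda>i. - \<mu> * shift y i"] seq_norm_mult[of N "- \<mu>" "shift y"]
    by (simp add: one_minus_shift_def[abs_def])
  also have "\<dots> \<le> seq_norm N y + cmod (- \<mu>) * seq_norm N y"
    by (intro add_left_mono mult_left_mono seq_norm_shift_le) simp
  finally show ?thesis by (simp add: algebra_simps)
qed

text \<open>A crude bound for the error term \<open>(1 - u S) y\<close>, where a constant factor is
  harmless.\<close>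

lemma seq_norm_one_minus_shift_funpow_le:
  assumes "cmod \<mu> \<le> 1"
  shows "seq_norm N ((one_minus_shift \<mu> ^^ m) y) \<le> 2 ^ m * seq_norm N y"
proof (induction m)
  case 0
  then show ?case by simp
next
  case (Suc m)
  have "seq_norm N ((one_minus_shift \<mu> ^^ Suc m) y)
      \<le> (1 + cmod \<mu>) * seq_norm N ((one_minus_shift \<mu> ^^ m) y)"
    using seq_norm_one_minus_shift_le by simp
  also have "\<dots> \<le> 2 * (2 ^ m * seq_norm N y)"
    using Suc assms by (intro mult_mono) (auto simp: seq_norm_nonneg)
  finally show ?case by simp
qed

text \<open>Sum the pointwise identity with \<open>b = S a\<close>. By \<open>y N = 0\<close> the
  shift loses nothing in the window, so the first two coefficients combine to
  \<open>(1 - r) - r (1 - r) = (1 - r)^2\<close>.\<close>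

lemma seq_norm_one_minus_shift_power2:
  assumes "cmod u = 1" and "y N = 0"
  shows "(seq_norm (Suc N) (one_minus_shift (of_real r * u) y))\<^sup>2
    = (1 - r)\<^sup>2 * (seq_norm (Suc N) y)\<^sup>2 + r * (seq_norm (Suc N) (one_minus_shift u y))\<^sup>2"
proof -
  have "(seq_norm (Suc N) (one_minus_shift (of_real r * u) y))\<^sup>2
      = (1 - r) * (seq_norm (Suc N) y)\<^sup>2 - r * (1 - r) * (seq_norm (Suc N) (shift y))\<^sup>2
        + r * (seq_norm (Suc N) (one_minus_shift u y))\<^sup>2"
    unfolding seq_norm_power2 one_minus_shift_def cmod_diff_mult_power2[OF assms(1)]
    by (simp only: sum.distrib sum_subtractf sum_distrib_left)
  moreover have "(seq_norm (Suc N) (shift y))\<^sup>2 = (seq_norm (Suc N) y)\<^sup>2"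
    unfolding seq_norm_shift unfolding seq_norm_power2 using assms(2) by simp
  ultimately show ?thesis by (simp add: power2_eq_square algebra_simps)
qed

lemma one_minus_shift_funpow_eq_0:
  assumes "\<And>i. i \<ge> M \<Longrightarrow> y i = 0" and "i \<ge> M + m"
  shows "(one_minus_shift \<mu> ^^ m) y i = 0"
  using assms(2)
proof (induction m arbitrary: i)
  case 0
  then show ?case using assms(1) by simp
next
  case (Suc m)
  then show ?case by (cases i) (simp_all add: one_minus_shift_def)
qed

text \<open>The norm identity is used once per factor. Each factor lengthens the support by at most
  one, so \<open>M + p \<le> N\<close> keeps the last entry zero before every application.\<close>

lemma seq_norm_one_minus_shift_funpow:
  assumes "cmod u = 1" and "0 \<le> r" and "r \<le> 1"
    and "\<And>i. i \<ge> M \<Longrightarrow> y i = 0" and "M + p \<le> N"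
  shows "(seq_norm N ((one_minus_shift (of_real r * u) ^^ p) y))\<^sup>2
    \<le> (1 - r) ^ (2 * p) * (seq_norm N y)\<^sup>2 + 4 ^ p * (seq_norm N (one_minus_shift u y))\<^sup>2"
  using assms(5)
proof (induction p)
  case 0
  then show ?case by simp
next
  case (Suc p)
  define \<mu> where "\<mu> = of_real r * u"
  have mu: "cmod \<mu> \<le> 1" using assms(1-3) by (simp add: \<mu>_def norm_mult)
  obtain N' where N': "N = Suc N'" using Suc.prems by (cases N) auto
  define z where "z = (one_minus_shift \<mu> ^^ p) y"
  define D where "D = (seq_norm N (one_minus_shift u y))\<^sup>2"
  have "z N' = 0"
    unfolding z_def using assms(4) by (rule one_minus_shift_funpow_eq_0) (use Suc.prems N' in auto)
  then have eq: "(seq_norm N (one_minus_shift \<mu> z))\<^sup>2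
      = (1 - r)\<^sup>2 * (seq_norm N z)\<^sup>2 + r * (seq_norm N (one_minus_shift u z))\<^sup>2"
    unfolding N' \<mu>_def by (rule seq_norm_one_minus_shift_power2[OF assms(1)])
  \<comment> \<open>Commuting the factors reduces the new error to \<open>(1 - u S) y\<close>, the
    same quantity in every round.\<close>
  have "one_minus_shift u z = (one_minus_shift \<mu> ^^ p) (one_minus_shift u y)"
    by (simp add: z_def one_minus_shift_funpow_commute)
  then have "(seq_norm N (one_minus_shift u z))\<^sup>2 \<le> (2 ^ p * seq_norm N (one_minus_shift u y))\<^sup>2"
    by (simp add: seq_norm_one_minus_shift_funpow_le[OF mu] seq_norm_nonneg power_mono)
  then have "(seq_norm N (one_minus_shift u z))\<^sup>2 \<le> 4 ^ p * D"
    by (simp add: D_def power_mult_distrib power_commutes flip: power_mult[of _ p 2])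
      (simp add: power_mult mult.commute[of p])
  then have 1: "r * (seq_norm N (one_minus_shift u z))\<^sup>2 \<le> 1 * (4 ^ p * D)"
    using assms(2,3) by (intro mult_mono) auto
  have "D \<ge> 0" by (simp add: D_def)
  have "(seq_norm N z)\<^sup>2 \<le> (1 - r) ^ (2 * p) * (seq_norm N y)\<^sup>2 + 4 ^ p * D"
    using Suc by (simp add: z_def \<mu>_def D_def)
  then have "(1 - r)\<^sup>2 * (seq_norm N z)\<^sup>2
      \<le> (1 - r)\<^sup>2 * ((1 - r) ^ (2 * p) * (seq_norm N y)\<^sup>2 + 4 ^ p * D)"
    by (rule mult_left_mono) simp
  also have "\<dots> = (1 - r) ^ (2 * Suc p) * (seq_norm N y)\<^sup>2 + (1 - r)\<^sup>2 * (4 ^ p * D)"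
    by (simp add: power2_eq_square algebra_simps)
  also have "(1 - r)\<^sup>2 * (4 ^ p * D) \<le> 1 * (4 ^ p * D)"
    using assms(2,3) \<open>D \<ge> 0\<close> by (intro mult_right_mono) (auto simp: power_le_one)
  \<comment> \<open>The inherited error and the new one are each at most \<open>4 ^ p * D\<close>;
    their sum fits into \<open>4 ^ Suc p * D\<close>.\<close>
  finally have "(seq_norm N (one_minus_shift \<mu> z))\<^sup>2
      \<le> (1 - r) ^ (2 * Suc p) * (seq_norm N y)\<^sup>2 + 2 * (4 ^ p * D)"
    using eq 1 by linarith
  also have "\<dots> \<le> (1 - r) ^ (2 * Suc p) * (seq_norm N y)\<^sup>2 + 4 ^ Suc p * D"
    using \<open>D \<ge> 0\<close> by simp
  finally show ?case by (simp add: z_def \<mu>_def D_def)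
qed

section \<open>The parabolic test vector\<close>

text \<open>Vanishes for \<open>j \<ge> M\<close> because of the truncated subtraction.\<close>

definition parabola :: "complex \<Rightarrow> nat \<Rightarrow> nat \<Rightarrow> complex"
  where "parabola u M j = u ^ j * of_nat ((j + 1) * (M - j))"

text \<open>The real parameter \<open>c\<close> stands for \<open>M\<close> but is kept apart from
  the number \<open>m\<close> of terms, so that the summand stays fixed in the induction. The next
  sum is treated likewise.\<close>

lemma sum_parabola_power2:
  "30 * (\<Sum>j<m. ((real j + 1) * (c - real j))\<^sup>2)
    = real m * (real m + 1) * (5 * c\<^sup>2 * (2 * real m + 1) - 5 * c * (3 * (real m)\<^sup>2 - real m - 2)
        + 6 * real m ^ 3 - 6 * (real m)\<^sup>2 - 4 * real m + 4)"
  by (induction m) (simp_all add: power2_eq_square power3_eq_cube algebra_simps)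

lemma sum_parabola_diff_power2:
  "3 * (\<Sum>j<m. (c - 2 * real j)\<^sup>2)
    = 3 * real m * c\<^sup>2 - 6 * c * real m * (real m - 1) + 2 * real m * (real m - 1) * (2 * real m - 1)"
  by (induction m) (simp_all add: power2_eq_square algebra_simps)


text \<open>The closed forms give \<open>((M + 1)^2 + 1) D = 10 V\<close> for the squared norms
  \<open>D\<close> and \<open>V\<close> of the difference and of the parabola. The product form also
  covers \<open>M = 0\<close>.\<close>

lemma seq_norm_parabola:
  assumes "cmod u = 1" and "M < N"
  shows "(real M + 1)\<^sup>2 * (seq_norm N (one_minus_shift u (parabola u M)))\<^sup>2
    \<le> 10 * (seq_norm N (parabola u M))\<^sup>2"
proof -
  have "(seq_norm N (parabola u M))\<^sup>2 = (\<Sum>j<N. (real ((j + 1) * (M - j)))\<^sup>2)"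
    unfolding seq_norm_power2 parabola_def norm_mult norm_power norm_of_nat assms(1) by simp
  also have "\<dots> = (\<Sum>j<M. ((real j + 1) * (real M - real j))\<^sup>2)"
  proof (intro sum.mono_neutral_cong_right ballI)
    fix j assume "j \<in> {..<M}"
    then have "j \<le> M" by simp
    then show "(real ((j + 1) * (M - j)))\<^sup>2 = ((real j + 1) * (real M - real j))\<^sup>2"
      by (simp only: of_nat_mult of_nat_diff of_nat_add of_nat_1)
  qed (use assms(2) in auto)
  finally have W: "30 * (seq_norm N (parabola u M))\<^sup>2
      = real M * (real M + 1) * (real M + 2) * ((real M + 1)\<^sup>2 + 1)"
    by (simp only: sum_parabola_power2) (simp add: power2_eq_square power3_eq_cube algebra_simps)
  \<comment> \<open>The phases \<open>u ^ j\<close> turn \<open>1 - u S\<close> into a plain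
    difference. The second product is the preceding value, and its factor \<open>j\<close> gives the
    correct 0 at \<open>j = 0\<close>.\<close>
  have D_eq: "cmod (one_minus_shift u (parabola u M) j)
      = \<bar>real ((j + 1) * (M - j)) - real (j * (M + 1 - j))\<bar>" for j
  proof (cases j)
    case 0
    then show ?thesis by (simp add: one_minus_shift_def parabola_def)
  next
    case (Suc i)
    have "one_minus_shift u (parabola u M) j
        = u ^ j * of_real (real ((j + 1) * (M - j)) - real (j * (M + 1 - j)))"
      unfolding Suc one_minus_shift_def shift_Suc parabola_def
      by (simp add: algebra_simps Suc_diff_Suc del: of_nat_add of_nat_mult of_nat_Suc)
    then show ?thesis
      using assms(1) by (simp only: norm_mult norm_power norm_of_real) simp
  qed
  \<comment> \<open>The parabola ends before \<open>M\<close>, but its difference has one more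
    nonzero term, \<open>-M\<close> at \<open>j = M\<close>; hence \<open>Suc M\<close>.\<close>
  have "(seq_norm N (one_minus_shift u (parabola u M)))\<^sup>2 = (\<Sum>j<Suc M. (real M - 2 * real j)\<^sup>2)"
    unfolding seq_norm_power2 D_eq power2_abs
  proof (intro sum.mono_neutral_cong_right ballI)
    fix j assume "j \<in> {..<Suc M}"
    then have "j \<le> M" by simp
    then have "real (M - j) = real M - real j" and "real (M + 1 - j) = real M + 1 - real j"
      by (simp_all add: of_nat_diff)
    then have "real ((j + 1) * (M - j)) - real (j * (M + 1 - j)) = real M - 2 * real j"
      by (simp only: of_nat_mult of_nat_add of_nat_1) (simp add: algebra_simps)
    then show "(real ((j + 1) * (M - j)) - real (j * (M + 1 - j)))\<^sup>2 = (real M - 2 * real j)\<^sup>2"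
      by (simp only:)
  qed (use assms(2) in auto)
  then have D: "3 * (seq_norm N (one_minus_shift u (parabola u M)))\<^sup>2
      = real M * (real M + 1) * (real M + 2)"
    by (simp only: sum_parabola_diff_power2) (simp add: power2_eq_square algebra_simps)
  have "30 * (seq_norm N (parabola u M))\<^sup>2
      = 3 * (seq_norm N (one_minus_shift u (parabola u M)))\<^sup>2 * ((real M + 1)\<^sup>2 + 1)"
    by (simp only: W D)
  also have "\<dots> \<ge> 3 * (seq_norm N (one_minus_shift u (parabola u M)))\<^sup>2 * (real M + 1)\<^sup>2"
    by (intro mult_left_mono) auto
  finally show ?thesis by simp
qed

section \<open>Eigenvector coordinates and the action of block matrices\<close>

definition coord :: "complex^'n^'n \<Rightarrow> 'n::finite \<Rightarrow> 'n block_vec \<Rightarrow> nat \<Rightarrow> complex"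
  where "coord U l x i = (matrix_inv U *v x i) $ l"

text \<open>The weight makes the eigenvector coordinates orthogonal: exchanging the sums over time
  and over coordinates splits the norm into scalar sequence norms.\<close>

lemma bv_norm_power2: "(bv_norm N U x)\<^sup>2 = (\<Sum>l\<in>UNIV. (seq_norm N (coord U l x))\<^sup>2)"
  unfolding bv_norm_def seq_norm_power2 coord_def
  by (subst sum.swap) (simp add: sum_nonneg norm_vec_def L2_set_def)

lemma bv_norm_nonneg: "0 \<le> bv_norm N U x"
  by (simp add: bv_norm_def sum_nonneg)

lemma sum_matrix_vector_mult:
  fixes A :: "'i \<Rightarrow> complex^'n^'m"
  shows "(\<Sum>i\<in>S. A i) *v x = (\<Sum>i\<in>S. A i *v x)"
  by (induction S rule: infinite_finite_induct) (simp_all add: matrix_vector_mult_add_rdistrib)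

lemma matrix_vector_mult_sum:
  fixes A :: "complex^'n^'m"
  shows "A *v (\<Sum>i\<in>S. x i) = (\<Sum>i\<in>S. A *v x i)"
  by (induction S rule: infinite_finite_induct) (simp_all add: matrix_vector_right_distrib)

lemma minus_matrix_vector_mult: "- A *v x = - (A *v x)" for A :: "complex^'n^'m"
  using matrix_vector_mult_diff_rdistrib[of 0 A x] by simp

lemma bm_vec_mult: "bm_vec N (bm_mult N A B) x = bm_vec N A (bm_vec N B x)"
proof
  fix i
  have "bm_vec N (bm_mult N A B) x i = (\<Sum>j<N. \<Sum>l<N. A i l *v (B l j *v x j))"
    by (simp add: bm_vec_def bm_mult_def sum_matrix_vector_mult matrix_vector_mul_assoc)
  also have "\<dots> = (\<Sum>l<N. \<Sum>j<N. A i l *v (B l j *v x j))"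
    by (rule sum.swap)
  finally show "bm_vec N (bm_mult N A B) x i = bm_vec N A (bm_vec N B x) i"
    by (simp add: bm_vec_def matrix_vector_mult_sum)
qed

lemma bm_vec_diff: "bm_vec N (A - B) x i = bm_vec N A x i - bm_vec N B x i"
  by (simp add: bm_vec_def matrix_vector_mult_diff_rdistrib sum_subtractf)

text \<open>One row of a block bidiagonal product: only columns \<open>i\<close> and
  \<open>i - 1\<close> contribute, and row 0 has no subdiagonal term.\<close>

lemma sum_bidiagonal:
  fixes f g :: "nat \<Rightarrow> 'a::comm_monoid_add"
  assumes "i < N"
  shows "(\<Sum>l<N. if i = l then f l else if i = Suc l then g l else 0)
    = f i + (case i of 0 \<Rightarrow> 0 | Suc m \<Rightarrow> g m)"
proof (cases i)
  case 0
  then show ?thesis using assms by (simp cong: if_cong)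
next
  case (Suc m)
  have "(\<Sum>l<N. if i = l then f l else if i = Suc l then g l else 0)
      = (\<Sum>l<N. (if i = l then f l else 0) + (if m = l then g l else 0))"
    using Suc by (intro sum.cong) auto
  then show ?thesis using assms Suc by (simp add: sum.distrib)
qed

lemma bm_vec_one: "i < N \<Longrightarrow> bm_vec N bm_one x i = x i"
  by (simp add: bm_vec_def bm_one_def if_distrib[of "\<lambda>A. A *v _"] cong: if_cong)

lemma bm_vec_A_Delta:
  assumes "i < N"
  shows "bm_vec N (A_Delta \<Phi> k) x i = x i - (case i of 0 \<Rightarrow> 0 | Suc m \<Rightarrow> matpow \<Phi> k *v x m)"
  using sum_bidiagonal[OF assms, of x "\<lambda>m. - matpow \<Phi> k *v x m"]
  by (simp add: bm_vec_def A_Delta_def minus_matrix_vector_mult if_distrib[of "\<lambda>A. A *v _"]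
      cong: if_cong split: nat.splits)

lemma bm_vec_B_Delta:
  assumes "i < N"
  shows "bm_vec N (B_Delta \<Psi>) x i = x i - (case i of 0 \<Rightarrow> 0 | Suc m \<Rightarrow> \<Psi> *v x m)"
  using sum_bidiagonal[OF assms, of x "\<lambda>m. - \<Psi> *v x m"]
  by (simp add: bm_vec_def B_Delta_def minus_matrix_vector_mult if_distrib[of "\<lambda>A. A *v _"]
      cong: if_cong split: nat.splits)

lemma bm_vec_A_cffc:
  assumes "i < N"
  shows "bm_vec N (A_cffc \<Phi> k) x i = (case i of 0 \<Rightarrow> 0 | Suc m \<Rightarrow> matpow \<Phi> k *v x m)"
proof -
  have "bm_vec N (A_cffc \<Phi> k) x i
      = (\<Sum>l<N. if i = l then 0 else if i = Suc l then matpow \<Phi> k *v x l else 0)"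
    unfolding bm_vec_def A_cffc_def by (intro sum.cong) auto
  then show ?thesis
    using sum_bidiagonal[OF assms, of "\<lambda>_. 0" "\<lambda>m. matpow \<Phi> k *v x m"] by simp
qed

lemma matpow_0 [simp]: "matpow A 0 = mat 1"
  and matpow_Suc [simp]: "matpow A (Suc m) = A ** matpow A m"
  by (simp_all add: matpow_def)

lemma matpow_Suc_right: "matpow A (Suc m) = matpow A m ** A"
  by (induction m) (simp_all add: matrix_mul_assoc)

text \<open>Exhibiting a two-sided inverse justifies the choice in \<open>bm_inv\<close>. Only the
  right-inverse equation is kept, for solving with \<open>B_Delta\<close>.\<close>

lemma bm_mult_bm_inv_B_Delta:
  assumes "i < N" and "j < N"
  shows "bm_mult N (B_Delta \<Psi>) (bm_inv N (B_Delta \<Psi>)) i j = bm_one i j"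
proof -
  \<comment> \<open>The finite Neumann series of the nilpotent subdiagonal part.\<close>
  define X where "X i j = (if j \<le> i then matpow \<Psi> (i - j) else 0)" for i j
  have minus_mult: "- \<Psi> ** A = - (\<Psi> ** A)" and mult_minus: "A ** - \<Psi> = - (A ** \<Psi>)" for A
    by (simp_all add: matrix_matrix_mult_def vec_eq_iff sum_negf)
  have "bm_mult N (B_Delta \<Psi>) X i j = bm_one i j \<and> bm_mult N X (B_Delta \<Psi>) i j = bm_one i j"
    if "i < N" "j < N" for i j
  proof
    have "bm_mult N (B_Delta \<Psi>) X i j
        = (\<Sum>l<N. if i = l then X l j else if i = Suc l then - (\<Psi> ** X l j) else 0)"
      unfolding bm_mult_def B_Delta_def by (intro sum.cong) (auto simp: minus_mult)
    also have "\<dots> = bm_one i j"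
      unfolding sum_bidiagonal[OF that(1)]
      by (cases i) (auto simp: X_def bm_one_def Suc_diff_le le_Suc_eq)
    finally show "bm_mult N (B_Delta \<Psi>) X i j = bm_one i j" .
    have "bm_mult N X (B_Delta \<Psi>) i j
        = (\<Sum>l<N. (if j = l then X i l else 0) + (if Suc j = l then - (X i l ** \<Psi>) else 0))"
      unfolding bm_mult_def B_Delta_def by (intro sum.cong) (auto simp: mult_minus)
    \<comment> \<open>The last column \<open>j = N - 1\<close> has no subdiagonal entry inside the
      window.\<close>
    also have "\<dots> = X i j + (if Suc j < N then - (X i (Suc j) ** \<Psi>) else 0)"
      using that by (simp add: sum.distrib)
    also have "\<dots> = bm_one i j"
    proof (cases "Suc j \<le> i")
      case True
      then have "i - j = Suc (i - Suc j)" by simp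
      then have "matpow \<Psi> (i - j) = matpow \<Psi> (i - Suc j) ** \<Psi>"
        by (simp only: matpow_Suc_right)
      then show ?thesis using True that by (simp add: X_def bm_one_def)
    next
      case False
      then show ?thesis by (auto simp: X_def bm_one_def)
    qed
    finally show "bm_mult N X (B_Delta \<Psi>) i j = bm_one i j" .
  qed
  then have "\<exists>X. \<forall>i<N. \<forall>j<N. bm_mult N (B_Delta \<Psi>) X i j = bm_one i j
      \<and> bm_mult N X (B_Delta \<Psi>) i j = bm_one i j"
    by blast
  from someI_ex[OF this, folded bm_inv_def] show ?thesis using assms by blast
qed

lemma bm_vec_cong: "(\<And>j. j < N \<Longrightarrow> A i j = B i j) \<Longrightarrow> bm_vec N A x i = bm_vec N B x i"
  by (simp add: bm_vec_def)

section \<open>Diagonalization and decoupling of the residuals\<close>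

lemma matrix_inv_mult:
  fixes U :: "complex^'n^'n"
  assumes "invertible U"
  shows "U ** matrix_inv U = mat 1" and "matrix_inv U ** U = mat 1"
  using someI_ex[OF assms[unfolded invertible_def]] by (simp_all add: matrix_inv_def)

text \<open>Expand \<open>x\<close> in the columns of \<open>U\<close>; \<open>M\<close> scales each
  of them by its eigenvalue.\<close>

lemma matrix_inv_diagonalized:
  fixes U :: "complex^'n^'n"
  assumes "diagonalized_by U M lam"
  shows "(matrix_inv U *v (M *v x)) $ l = lam l * (matrix_inv U *v x) $ l"
proof -
  have inv: "invertible U" and col: "\<And>l. M *v column l U = lam l *s column l U"
    using assms by (simp_all add: diagonalized_by_def)
  define y where "y = matrix_inv U *v x"
  have "x = U *v y"
    by (simp add: y_def matrix_vector_mul_assoc matrix_inv_mult[OF inv])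
  then have "M *v x = (\<Sum>l\<in>UNIV. M *v (y $ l *s column l U))"
    by (simp add: matrix_mult_sum[of U] matrix_vector_mult_sum)
  also have "\<dots> = (\<Sum>l\<in>UNIV. (lam l * y $ l) *s column l U)"
    by (simp add: vector_scalar_commute col vector_smult_assoc mult.commute)
  also have "\<dots> = U *v (\<chi> l. lam l * y $ l)"
    by (simp add: matrix_mult_sum[of U])
  finally have "matrix_inv U *v (M *v x) = (\<chi> l. lam l * y $ l)"
    by (simp add: matrix_vector_mul_assoc matrix_inv_mult[OF inv])
  then show ?thesis by (simp add: y_def)
qed

lemma matrix_inv_matpow:
  fixes U :: "complex^'n^'n"
  assumes "diagonalized_by U M lam"
  shows "(matrix_inv U *v (matpow M m *v x)) $ l = lam l ^ m * (matrix_inv U *v x) $ l"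
  by (induction m)
    (simp_all add: matrix_inv_diagonalized[OF assms] mult.assoc flip: matrix_vector_mul_assoc)

text \<open>Let \<open>z\<close> be the inverse of \<open>B_Delta\<close> applied to
  \<open>x\<close>. In coordinates \<open>z = \<mu> S z + x\<close>, so
  \<open>x - z + \<lambda>^k S z = (\<lambda>^k - \<mu>) S z\<close>, and \<open>S z\<close> is
  \<open>geo_shift\<close> of \<open>x\<close>.\<close>

lemma coord_F_residual:
  assumes "diagonalized_by U \<Phi> lam" and "diagonalized_by U \<Psi> mu" and "i < N"
  shows "coord U l (bm_vec N (F_residual N \<Phi> \<Psi> k) x) i
    = toeplitz (lam l ^ k - mu l) (mu l) 0 (coord U l x) i"
proof -
  define z where "z = bm_vec N (bm_inv N (B_Delta \<Psi>)) x"
  have z: "coord U l z i = mu l * shift (coord U l z) i + coord U l x i" if "i < N" for i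
  proof -
    have "bm_vec N (B_Delta \<Psi>) z i = bm_vec N bm_one x i"
      unfolding z_def bm_vec_mult[symmetric]
      by (intro bm_vec_cong bm_mult_bm_inv_B_Delta that)
    then have "z i = (case i of 0 \<Rightarrow> 0 | Suc m \<Rightarrow> \<Psi> *v z m) + x i"
      by (simp add: bm_vec_B_Delta bm_vec_one that algebra_simps)
    then have "coord U l z i = (matrix_inv U *v ((case i of 0 \<Rightarrow> 0 | Suc m \<Rightarrow> \<Psi> *v z m) + x i)) $ l"
      by (simp add: coord_def)
    then show ?thesis
      by (cases i) (simp_all add: coord_def matrix_vector_right_distrib
          matrix_inv_diagonalized[OF assms(2)])
  qed
  have geo: "shift (coord U l z) i = geo_shift (mu l) (coord U l x) i" if "i < N" for i
    using that
  proof (induction i)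
    case (Suc i)
    then show ?case using z[of i] by simp
  qed simp
  have "coord U l (bm_vec N (F_residual N \<Phi> \<Psi> k) x) i
      = coord U l x i - coord U l z i + lam l ^ k * shift (coord U l z) i"
    using assms(3)
    by (cases i) (simp_all add: coord_def F_residual_def bm_vec_diff bm_vec_mult bm_vec_one
        bm_vec_A_Delta flip: z_def,
        simp_all add: matrix_vector_mult_diff_distrib matrix_inv_matpow[OF assms(1)])
  then show ?thesis
    unfolding z[OF assms(3)] by (simp add: toeplitz_def geo assms(3) algebra_simps)
qed

text \<open>\<open>A_cffc\<close> acts in coordinates as \<open>\<lambda>^k S\<close>: the scalar
  joins the coefficient by linearity, and the shift raises \<open>e\<close> from 0 to 1.\<close>

lemma coord_FCF_residual:
  assumes "diagonalized_by U \<Phi> lam" and "diagonalized_by U \<Psi> mu" and "i < N"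
  shows "coord U l (bm_vec N (FCF_residual N \<Phi> \<Psi> k) x) i
    = toeplitz ((lam l ^ k - mu l) * lam l ^ k) (mu l) 1 (coord U l x) i"
proof -
  have "coord U l (bm_vec N (A_cffc \<Phi> k) x) j = lam l ^ k * shift (coord U l x) j" if "j < N" for j
    using that by (cases j)
      (simp_all add: coord_def bm_vec_A_cffc matrix_inv_matpow[OF assms(1)])
  then have "coord U l (bm_vec N (FCF_residual N \<Phi> \<Psi> k) x) i
      = toeplitz (lam l ^ k - mu l) (mu l) 0 (\<lambda>j. lam l ^ k * shift (coord U l x) j) i"
    unfolding FCF_residual_def bm_vec_mult coord_F_residual[OF assms]
    by (intro toeplitz_cong[OF _ assms(3)]) auto
  moreover have "geo_shift \<mu> (\<lambda>j. c * y j) i = c * geo_shift \<mu> y i" for \<mu> c y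
    by (induction i) (simp_all add: algebra_simps)
  ultimately show ?thesis by (simp add: toeplitz_def)
qed

text \<open>Applying \<open>\<Psi>^q\<close> to the eigenvector in column \<open>l\<close> bounds
  \<open>|\<mu>|^q\<close> by the operator norm of \<open>\<Psi>^q\<close>.\<close>

lemma diagonalized_by_cmod_less_1:
  fixes U \<Psi> :: "complex^'n^'n"
  assumes "diagonalized_by U \<Psi> mu" and "onorm ((*v) (matpow \<Psi> q)) < 1" and "q \<ge> 1"
  shows "cmod (mu l) < 1"
proof -
  have inv: "invertible U" using assms(1) by (simp add: diagonalized_by_def)
  define x where "x = column l U"
  have "matrix_inv U *v x = column l (matrix_inv U ** U)"
    by (simp add: x_def column_def matrix_vector_mult_def matrix_matrix_mult_def vec_eq_iff)
  then have "(matrix_inv U *v x) $ l = 1"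
    by (simp add: matrix_inv_mult[OF inv] column_def mat_def)
  then have "x \<noteq> 0" by auto
  have ev: "matpow \<Psi> m *v x = mu l ^ m *s x" for m
    using assms(1) unfolding diagonalized_by_def x_def
    by (induction m)
      (simp_all add: vector_scalar_commute vector_smult_assoc mult.commute flip: matrix_vector_mul_assoc)
  have "norm (mu l ^ q *s x) \<le> onorm ((*v) (matpow \<Psi> q)) * norm x"
    unfolding ev[symmetric] by (rule onorm) simp
  moreover have "norm (mu l ^ q *s x) = cmod (mu l) ^ q * norm x"
    by (simp add: norm_vec_def norm_mult norm_power L2_set_right_distrib)
  moreover have "onorm ((*v) (matpow \<Psi> q)) * norm x < 1 * norm x"
    using assms(2) \<open>x \<noteq> 0\<close> by (intro mult_strict_right_mono) auto
  ultimately have "cmod (mu l) ^ q * norm x < 1 * norm x"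
    by linarith
  then have "cmod (mu l) ^ q < 1" using \<open>x \<noteq> 0\<close> by simp
  then show ?thesis by (meson linorder_not_less one_le_power)
qed

section \<open>Asymptotics of the operator norm\<close>

text \<open>Covers both relaxations. The upper bound holds in every coordinate; the lower bound
  tests a single coordinate, one in which \<phi> is attained.\<close>

lemma bm_norm_power_asymptotics:
  fixes U :: "complex^'n^'n" and A :: "nat \<Rightarrow> 'n block_mat" and c mu :: "'n \<Rightarrow> complex"
  assumes inv: "invertible U"
    and coord: "\<And>N x l i. i < N \<Longrightarrow>
      coord U l (bm_vec N (A N) x) i = toeplitz (c l) (mu l) e (coord U l x) i"
    and mu: "\<And>l. cmod (mu l) < 1"
    and bound: "\<And>l. cmod (c l) \<le> \<phi> * (1 - cmod (mu l))"
    and least: "\<And>b. \<forall>l. cmod (c l) \<le> b * (1 - cmod (mu l)) \<Longrightarrow> \<phi> \<le> b"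
    and "p \<ge> 1"
  shows "eq_minus_bigo_inv_square (\<lambda>N. (bm_norm N U (bm_power N (A N) p))\<^sup>2) (\<phi> ^ (2 * p))"
proof -
  have coord_power: "coord U l (bm_vec N (bm_power N (A N) m) x) i
      = (toeplitz (c l) (mu l) e ^^ m) (coord U l x) i" if "i < N" for N m l x i
    using that
  proof (induction m arbitrary: i)
    case 0
    then show ?case by (simp add: bm_power_def coord_def bm_vec_one)
  next
    case (Suc m)
    have "coord U l (bm_vec N (bm_power N (A N) (Suc m)) x) i
        = toeplitz (c l) (mu l) e (coord U l (bm_vec N (bm_power N (A N) m) x)) i"
      by (simp add: bm_power_def bm_vec_mult coord[OF Suc.prems])
    also have "\<dots> = toeplitz (c l) (mu l) e ((toeplitz (c l) (mu l) e ^^ m) (coord U l x)) i"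
      by (rule toeplitz_cong[OF Suc.IH Suc.prems])
    finally show ?case by simp
  qed
  then have norm_coord: "seq_norm N (coord U l (bm_vec N (bm_power N (A N) p) x))
      = seq_norm N ((toeplitz (c l) (mu l) e ^^ p) (coord U l x))" for N l x
    by (simp add: seq_norm_def L2_set_def)

  have "cmod (c l) / (1 - cmod (mu l)) \<le> \<phi>" for l
    using bound[of l] mu[of l] by (simp add: field_simps)
  then have "\<phi> \<ge> 0"
    using mu[of undefined] by (meson diff_ge_0_iff_ge divide_nonneg_nonneg less_imp_le norm_ge_zero order_trans)
  \<comment> \<open>The maximum of the finitely many quotients is itself an admissible constant, so
    leastness makes \<phi> equal to it.\<close>
  obtain l where l: "\<phi> * (1 - cmod (mu l)) = cmod (c l)"
  proof -
    define R where "R = range (\<lambda>l. cmod (c l) / (1 - cmod (mu l)))"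
    define m where "m = Max R"
    have "m \<in> R" unfolding m_def R_def by (intro Max_in) auto
    then obtain l where l: "m = cmod (c l) / (1 - cmod (mu l))" by (auto simp: R_def)
    have "cmod (c l') \<le> m * (1 - cmod (mu l'))" for l'
    proof -
      have "cmod (c l') / (1 - cmod (mu l')) \<le> m"
        unfolding m_def R_def by (intro Max_ge) auto
      then show ?thesis using mu[of l'] by (simp add: field_simps)
    qed
    then have "\<phi> \<le> m" using least by blast
    then have "\<phi> * (1 - cmod (mu l)) \<le> cmod (c l)" using mu[of l] by (simp add: l field_simps)
    then show ?thesis using bound[of l] that by force
  qed

  define f where "f N = bm_norm N U (bm_power N (A N) p)" for N
  have upper: "bv_norm N U (bm_vec N (bm_power N (A N) p) x) \<le> \<phi> ^ p * bv_norm N U x" for N x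
  proof (rule power2_le_imp_le)
    have "(bv_norm N U (bm_vec N (bm_power N (A N) p) x))\<^sup>2
        \<le> (\<Sum>l\<in>UNIV. (\<phi> ^ p * seq_norm N (coord U l x))\<^sup>2)"
      unfolding bv_norm_power2 norm_coord
      by (intro sum_mono power_mono seq_norm_toeplitz_funpow mu bound seq_norm_nonneg)
    also have "\<dots> = (\<phi> ^ p * bv_norm N U x)\<^sup>2"
      by (simp add: power_mult_distrib bv_norm_power2 sum_distrib_left)
    finally show "(bv_norm N U (bm_vec N (bm_power N (A N) p) x))\<^sup>2 \<le> (\<phi> ^ p * bv_norm N U x)\<^sup>2" .
  qed (simp add: \<open>\<phi> \<ge> 0\<close> bv_norm_nonneg)
  \<comment> \<open>For \<open>x\<close> of norm zero the quotient is 0 by the convention for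
    division.\<close>
  have ratio: "bv_norm N U (bm_vec N (bm_power N (A N) p) x) / bv_norm N U x \<le> \<phi> ^ p" for N x
  proof (cases "bv_norm N U x = 0")
    case False
    then have "bv_norm N U x > 0" using bv_norm_nonneg[of N U x] by linarith
    then show ?thesis using upper[of N x] by (simp add: field_simps)
  qed (simp add: \<open>\<phi> \<ge> 0\<close>)
  then have bdd: "bdd_above (range (\<lambda>x. bv_norm N U (bm_vec N (bm_power N (A N) p) x) / bv_norm N U x))" for N
    by (intro bdd_aboveI[where M = "\<phi> ^ p"]) auto
  have f_le: "f N \<le> \<phi> ^ p" for N
    unfolding f_def bm_norm_def by (intro cSUP_least ratio) simp
  have f_ge: "bv_norm N U (bm_vec N (bm_power N (A N) p) x) / bv_norm N U x \<le> f N" for N x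
    unfolding f_def bm_norm_def by (intro cSUP_upper bdd) simp
  have f_nonneg: "0 \<le> f N" for N
    using f_ge[of N undefined] bv_norm_nonneg by (meson divide_nonneg_nonneg order_trans)
  \<comment> \<open>At norm zero the quotient carries no information; there \<open>upper\<close>
    shows that the image has norm zero too.\<close>
  have lower: "bv_norm N U (bm_vec N (bm_power N (A N) p) x) \<le> f N * bv_norm N U x" for N x
  proof (cases "bv_norm N U x = 0")
    case True
    then show ?thesis using upper[of N x] by simp
  next
    case False
    then have "bv_norm N U x > 0" using bv_norm_nonneg[of N U x] by linarith
    then show ?thesis using f_ge[of N x] by (simp add: field_simps)
  qed

  define r where "r = cmod (mu l)"
  have r: "0 \<le> r" "r < 1" using mu by (simp_all add: r_def)
  obtain u where u: "cmod u = 1" "mu l = of_real r * u"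
  proof (cases "mu l = 0")
    case True
    then show ?thesis using that[of 1] by (simp add: r_def)
  next
    case False
    then show ?thesis using that[of "mu l / of_real r"] by (simp add: r_def norm_divide)
  qed
  \<comment> \<open>\<open>s\<close> counts the shifts in the \<open>p\<close>th power;
    \<open>a\<close> is the leading coefficient of the squared norm of
    \<open>(1 - \<mu> S)^p v\<close> relative to that of \<open>v\<close>.\<close>
  define s where "s = Suc e * p"
  define a where "a = (1 - r) ^ (2 * p)"
  have "a > 0" using r by (simp add: a_def)
  \<comment> \<open>\<open>N > 2 * s\<close> gives \<open>N \<le> 2 (M + 1)\<close> for
    \<open>M = N - s\<close>, so \<open>10 / (M + 1)^2 \<le> 40 / N^2\<close>.\<close>
  have main: "\<phi> ^ (2 * p) - (f N)\<^sup>2 \<le> (\<phi> ^ (2 * p) * 40 * 4 ^ p / a) * (1 / real N ^ 2)"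
    if N: "N > 2 * s" for N
  proof -
    define M where "M = N - s"
    have M: "N = M + s" "M \<ge> 1" "p \<le> s" using N by (auto simp: M_def s_def)
    define v where "v = parabola u M"
    define w where "w = (one_minus_shift (mu l) ^^ p) v"
    \<comment> \<open>The scalar test sequence is placed in the direction of eigenvector
      \<open>l\<close>; all other coordinates vanish.\<close>
    define x where "x i = U *v axis l (w i)" for i
    have x: "coord U l' x = (if l' = l then w else (\<lambda>_. 0))" for l'
      by (rule ext) (simp add: coord_def x_def matrix_vector_mul_assoc matrix_inv_mult[OF inv] axis_def)
    define V where "V = (seq_norm N v)\<^sup>2"
    have v0: "v i = 0" if "i \<ge> M" for i using that by (simp add: v_def parabola_def)
    have VM: "V = (seq_norm M v)\<^sup>2"
      unfolding V_def seq_norm_power2 by (rule sum.mono_neutral_right) (auto simp: M v0)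
    have "v 0 \<noteq> 0" using M by (simp add: v_def parabola_def)
    then have "V > 0"
      unfolding V_def seq_norm_power2 using M by (intro sum_pos2[where i = 0]) auto
    have bvx: "(bv_norm N U x)\<^sup>2 = (seq_norm N w)\<^sup>2"
      unfolding bv_norm_power2 x by (subst sum.remove[of _ l]) (simp_all add: seq_norm_def L2_set_def)
    \<comment> \<open>The power maps \<open>w\<close> to \<open>c^p S^s v\<close>, and the window
      \<open>M + s\<close> retains all of it.\<close>
    have "(cmod (c l)) ^ (2 * p) * V = (seq_norm N ((toeplitz (c l) (mu l) e ^^ p) w))\<^sup>2"
      unfolding w_def toeplitz_funpow seq_norm_mult s_def[symmetric] M(1) seq_norm_shift_funpow
      by (simp add: VM norm_power power_mult_distrib power_mult[symmetric] mult.commute[of p])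
    also have "\<dots> \<le> (bv_norm N U (bm_vec N (bm_power N (A N) p) x))\<^sup>2"
      unfolding bv_norm_power2 norm_coord
      using member_le_sum[of l UNIV "\<lambda>l. (seq_norm N ((toeplitz (c l) (mu l) e ^^ p) (coord U l x)))\<^sup>2"]
      by (simp add: x)
    also have "\<dots> \<le> (f N * bv_norm N U x)\<^sup>2"
      by (intro power_mono lower bv_norm_nonneg)
    also have "\<dots> = (f N)\<^sup>2 * (seq_norm N w)\<^sup>2"
      by (simp add: power_mult_distrib bvx)
    also have "\<dots> \<le> (f N)\<^sup>2 * (a * V + 4 ^ p * (seq_norm N (one_minus_shift u v))\<^sup>2)"
      unfolding w_def u(2) a_def V_def using r M v0
      by (intro mult_left_mono seq_norm_one_minus_shift_funpow u) auto
    also have "\<dots> \<le> (f N)\<^sup>2 * (a * V + 4 ^ p * (40 / real N ^ 2 * V))"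
    proof -
      have "M < N" using M \<open>p \<ge> 1\<close> by simp
      have "real N ^ 2 * (seq_norm N (one_minus_shift u v))\<^sup>2
          \<le> (2 * (real M + 1)) ^ 2 * (seq_norm N (one_minus_shift u v))\<^sup>2"
        using N M by (intro mult_right_mono power_mono) auto
      also have "\<dots> = 4 * ((real M + 1)\<^sup>2 * (seq_norm N (one_minus_shift u v))\<^sup>2)"
        by (simp only: power_mult_distrib) simp
      also have "\<dots> \<le> 40 * V"
        using seq_norm_parabola[OF u(1) \<open>M < N\<close>] by (simp add: v_def V_def)
      finally have "(seq_norm N (one_minus_shift u v))\<^sup>2 \<le> 40 / real N ^ 2 * V"
        using N by (simp add: field_simps)
      then show ?thesis by (intro mult_left_mono add_left_mono) auto
    qed
    \<comment> \<open>The choice of \<open>l\<close> turns \<open>|c|^(2p)\<close> into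
      \<open>\<phi>^(2p) a\<close>.\<close>
    finally have "\<phi> ^ (2 * p) * a * V \<le> (f N)\<^sup>2 * (a + 4 ^ p * 40 / real N ^ 2) * V"
      unfolding l[symmetric] r_def[symmetric] a_def power_mult_distrib by (simp add: algebra_simps)
    then have "\<phi> ^ (2 * p) * a \<le> (f N)\<^sup>2 * (a + 4 ^ p * 40 / real N ^ 2)"
      using \<open>V > 0\<close> by (rule mult_right_le_imp_le)
    also have "\<dots> = (f N)\<^sup>2 * a + (f N)\<^sup>2 * (4 ^ p * 40 / real N ^ 2)"
      by (rule distrib_left)
    \<comment> \<open>In the error term alone, \<open>f N\<close> is replaced by its upper bound, so
      that the constant does not depend on \<open>N\<close>.\<close>
    also have "(f N)\<^sup>2 * (4 ^ p * 40 / real N ^ 2) \<le> \<phi> ^ (2 * p) * (4 ^ p * 40 / real N ^ 2)"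
      using power_mono[OF f_le f_nonneg, of N 2]
      by (intro mult_right_mono) (simp_all add: power_mult mult.commute[of 2])
    finally have "(\<phi> ^ (2 * p) - (f N)\<^sup>2) * a \<le> \<phi> ^ (2 * p) * (4 ^ p * 40 / real N ^ 2)"
      by (simp add: algebra_simps)
    then have "\<phi> ^ (2 * p) - (f N)\<^sup>2 \<le> \<phi> ^ (2 * p) * (4 ^ p * 40 / real N ^ 2) / a"
      using \<open>a > 0\<close> by (simp only: pos_le_divide_eq)
    then show ?thesis by (simp add: mult_ac)
  qed
  have diff_nonneg: "0 \<le> \<phi> ^ (2 * p) - (f N)\<^sup>2" for N
    using power_mono[OF f_le f_nonneg, of N 2] by (simp add: power_mult mult.commute[of 2])
  have "(\<lambda>N. \<phi> ^ (2 * p) - (f N)\<^sup>2) \<in> O(\<lambda>N. 1 / real N ^ 2)"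
  proof (rule bigoI[where c = "\<phi> ^ (2 * p) * 40 * 4 ^ p / a"])
    show "\<forall>\<^sub>F N in sequentially. norm (\<phi> ^ (2 * p) - (f N)\<^sup>2)
        \<le> (\<phi> ^ (2 * p) * 40 * 4 ^ p / a) * norm (1 / real N ^ 2)"
      using eventually_gt_at_top[of "2 * s"]
    proof eventually_elim
      case (elim N)
      show ?case using main[OF elim] diff_nonneg[of N] by simp
    qed
  qed
  with diff_nonneg show ?thesis
    unfolding eq_minus_bigo_inv_square_def f_def[symmetric]
    by (intro exI[where x = "\<lambda>N. \<phi> ^ (2 * p) - (f N)\<^sup>2"]) simp
qed

section \<open>F- and FCF-relaxation as two instances\<close>

theorem theorem5p4:
  fixes \<Phi> \<Psi> U :: "complex^'n^'n"
    and lam mu :: "'n \<Rightarrow> complex"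
    and k p q :: nat
    and \<phi>\<^sub>F \<phi>\<^sub>F\<^sub>C\<^sub>F :: real
  assumes "invertible \<Phi>" and "invertible \<Psi>"
    and "q \<ge> 1"
    and "onorm ((*v) (matpow \<Phi> q)) < 1" and "onorm ((*v) (matpow \<Psi> q)) < 1"
    and "k \<ge> 1"
    and "\<Phi> ** \<Psi> = \<Psi> ** \<Phi>"
    and "diagonalized_by U \<Phi> lam" and "diagonalized_by U \<Psi> mu"
    and "p \<ge> 1"
  shows "(F_TEAP lam mu k \<phi>\<^sub>F \<and> (\<forall>c. F_TEAP lam mu k c \<longrightarrow> \<phi>\<^sub>F \<le> c) \<longrightarrow>
            eq_minus_bigo_inv_square
              (\<lambda>N\<^sub>c. (bm_norm N\<^sub>c U (bm_power N\<^sub>c (F_residual N\<^sub>c \<Phi> \<Psi> k) p))\<^sup>2)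
              (\<phi>\<^sub>F ^ (2 * p)))
       \<and> (FCF_TEAP lam mu k \<phi>\<^sub>F\<^sub>C\<^sub>F \<and> (\<forall>c. FCF_TEAP lam mu k c \<longrightarrow> \<phi>\<^sub>F\<^sub>C\<^sub>F \<le> c) \<longrightarrow>
            eq_minus_bigo_inv_square
              (\<lambda>N\<^sub>c. (bm_norm N\<^sub>c U (bm_power N\<^sub>c (FCF_residual N\<^sub>c \<Phi> \<Psi> k) p))\<^sup>2)
              (\<phi>\<^sub>F\<^sub>C\<^sub>F ^ (2 * p)))"
proof -
  have inv: "invertible U" using assms(8) by (simp add: diagonalized_by_def)
  have mu: "cmod (mu l) < 1" for l
    by (rule diagonalized_by_cmod_less_1[OF assms(9,5,3)])
  \<comment> \<open>A zero eigenvalue would make coordinate \<open>l\<close> vanish on the range of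
    \<Phi>, contradicting surjectivity. Nonzero eigenvalues allow clearing the denominator in the
    FCF-TEAP.\<close>
  have lam: "lam l \<noteq> 0" for l
  proof
    assume "lam l = 0"
    define x where "x = U *v axis l 1"
    have "(matrix_inv U *v x) $ l = 1"
      by (simp add: x_def matrix_vector_mul_assoc matrix_inv_mult[OF inv])
    moreover have "x = \<Phi> *v (matrix_inv \<Phi> *v x)"
      by (simp add: matrix_vector_mul_assoc matrix_inv_mult[OF assms(1)])
    ultimately have "lam l * (matrix_inv U *v (matrix_inv \<Phi> *v x)) $ l = 1"
      by (metis matrix_inv_diagonalized[OF assms(8)])
    then show False using \<open>lam l = 0\<close> by simp
  qed
  have F_iff: "F_TEAP lam mu k b
      \<longleftrightarrow> (\<forall>l. cmod (lam l ^ k - mu l) \<le> b * (1 - cmod (mu l)))" for b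
    by (simp add: F_TEAP_def norm_minus_commute)
  \<comment> \<open>Multiplying by \<open>|\<lambda>^k|\<close> gives the F-type inequality with the
    FCF coefficient on the left.\<close>
  have FCF_iff: "FCF_TEAP lam mu k b
      \<longleftrightarrow> (\<forall>l. cmod ((lam l ^ k - mu l) * lam l ^ k) \<le> b * (1 - cmod (mu l)))" for b
    using lam by (simp add: FCF_TEAP_def norm_mult norm_minus_commute[of "mu _"] pos_le_divide_eq)
  have F: "eq_minus_bigo_inv_square
      (\<lambda>N. (bm_norm N U (bm_power N (F_residual N \<Phi> \<Psi> k) p))\<^sup>2) (\<phi> ^ (2 * p))"
    if "F_TEAP lam mu k \<phi>" and "\<And>b. F_TEAP lam mu k b \<Longrightarrow> \<phi> \<le> b" for \<phi>
    by (rule bm_norm_power_asymptotics[where A = "\<lambda>N. F_residual N \<Phi> \<Psi> k",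
          OF inv coord_F_residual[OF assms(8,9)] mu _ _ assms(10)])
      (use that[unfolded F_iff] in blast)+
  have FCF: "eq_minus_bigo_inv_square
      (\<lambda>N. (bm_norm N U (bm_power N (FCF_residual N \<Phi> \<Psi> k) p))\<^sup>2) (\<phi> ^ (2 * p))"
    if "FCF_TEAP lam mu k \<phi>" and "\<And>b. FCF_TEAP lam mu k b \<Longrightarrow> \<phi> \<le> b" for \<phi>
    by (rule bm_norm_power_asymptotics[where A = "\<lambda>N. FCF_residual N \<Phi> \<Psi> k",
          OF inv coord_FCF_residual[OF assms(8,9)] mu _ _ assms(10)])
      (use that[unfolded FCF_iff] in blast)+
  show ?thesis by (intro conjI impI F FCF) blast+
qed

end
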